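(* Fix $\mu\ge0$ and let $R:\mathbb{R}^p\times\mathbb{R}^q\to\mathbb{R}_+\cup\{+\infty\}$ be lower semicontinuous and finite at some point of $\mathbb{R}^p\times\mathbb{R}^q_+$. If $\mu=0$, assume that $R$ is level compact; if $\mu>0$, assume that $R$ is 1-coercive. Let $\{\eta_k\}\subset\mathbb{R}_{++}$ satisfy $\eta_k<\eta_{k+1}$ for all $k$ and $\eta_k\uparrow\infty$, and for each $k\in\mathbb{N}$ let $((\beta^k,\gamma^k),(\tilde\beta^k,\tilde\gamma^k))$ be an optimal solution of $$\min_{(\beta,\gamma),(\tilde\beta,\tilde\gamma)}\ \mathcal{L}_{\eta_k,\mu}((\beta,\gamma),(\tilde\beta,\tilde\gamma))+R(\tilde\beta,\tilde\gamma)+\delta_{\mathbb{R}^q_+}(\tilde\gamma).$$ Then any limit point (cluster point) $((\bar\beta,\bar\gamma),(\hat\beta,\hat\gamma))$ of the sequence $\{((\beta^k,\gamma^k),(\tilde\beta^k,\tilde\gamma^k))\}$ satisfies $(\bar\beta,\bar\gamma)=(\hat\beta,\hat\gamma)$, and $(\bar\beta,\bar\gamma)$ is an optimal solution of $$\min_{(\beta,\gamma)\in\mathbb{R}^p\times\mathbb{R}^q_+}\ \mathcal{L}(\beta,\gamma)+\phi_\mu(\gamma)+R(\beta,\gamma).$$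
   Context: Fix integers $m,p,q\ge1$, $n_1,\dots,n_m\ge1$ and, for $i=1,\dots,m$, data $X_i\in\mathbb{R}^{n_i\times p}$, $Z_i\in\mathbb{R}^{n_i\times q}$, $Y_i\in\mathbb{R}^{n_i}$ and symmetric positive definite $\Lambda_i\in\mathbb{R}^{n_i\times n_i}$. Let $\Omega_i(\gamma):=Z_i\,\mathrm{Diag}(\gamma)Z_i^T+\Lambda_i$ and $$\mathcal{L}(\beta,\gamma):=\sum_{i=1}^m\tfrac12(Y_i-X_i\beta)^T\Omega_i(\gamma)^{-1}(Y_i-X_i\beta)+\tfrac12\ln\det\Omega_i(\gamma),\quad (\beta,\gamma)\in\mathbb{R}^p\times\mathbb{R}^q_+.$$ For $\mu>0$ let $\phi_\mu(\gamma):=-\mu\sum_{i=1}^q\ln(\gamma_i/\mu)$ if all $\gamma_i>0$ and $+\infty$ otherwise; $\phi_0:=\delta_{\mathbb{R}^q_+}$, where $\delta_C$ is the indicator function of $C$ ($0$ on $C$, $+\infty$ off $C$). Define $$\mathcal{L}_{\eta,\mu}((\beta,\gamma),(\tilde\beta,\tilde\gamma)):=\mathcal{L}(\beta,\gamma)+\phi_\mu(\gamma)+\tfrac{\eta}{2}\big(\|\beta-\tilde\beta\|^2+\|\gamma-\tilde\gamma\|^2\big),$$ equal to $+\infty$ when $\gamma\notin\mathrm{dom}\,\phi_\mu$. $R$ is level compact if its epigraph is closed and all sets $\{R\le\nu\}$, $\nu\in\mathbb{R}$, are bounded; $R$ is 1-coercive if $\liminf_{\|w\|\to\infty}R(w)/\|w\|>0$.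 An optimal solution is a feasible point attaining the infimum of the objective in $\mathbb{R}\cup\{+\infty\}$. *)

theory Defs
  imports
    "HOL-Analysis.Analysis"
    "Jordan_Normal_Form.Gauss_Jordan_Elimination"
    "Jordan_Normal_Form.Determinant"
begin

text \<open>
  The sizes \<open>n i\<close> vary with \<open>i\<close>, so the matrices \<open>\<Lambda> i\<close> and \<open>\<Omega> i\<close> are dynamically sized matrices,
  while \<open>\<beta>\<close> and \<open>\<gamma>\<close> live in the Euclidean spaces \<open>real ^ 'p\<close> and \<open>real ^ 'q\<close>.
  The design matrices are given by their rows: \<open>X i j\<close> and \<open>Z i j\<close> are the \<open>j\<close>-th rows of the
  \<open>n i \<times> p\<close> and \<open>n i \<times> q\<close> matrices, for \<open>j < n i\<close>; values at other \<open>j\<close> are never used.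
\<close>

unbundle no inner_syntax
unbundle no vec_syntax

definition sym_pos_def :: "nat \<Rightarrow> real mat \<Rightarrow> bool" where
  "sym_pos_def d A \<longleftrightarrow> A \<in> carrier_mat d d \<and> transpose_mat A = A \<and>
     (\<forall>v \<in> carrier_vec d. v \<noteq> 0\<^sub>v d \<longrightarrow> v \<bullet> (A *\<^sub>v v) > 0)"

text \<open>The summand is the \<open>(j, k)\<close> entry of \<open>Z Diag(\<gamma>) Z\<^sup>T\<close>.\<close>

definition Omega :: "nat \<Rightarrow> (nat \<Rightarrow> real ^ 'q) \<Rightarrow> real mat \<Rightarrow> real ^ 'q \<Rightarrow> real mat" where
  "Omega d Z \<Lambda> \<gamma> =
     Matrix.mat d d (\<lambda>(j, k). \<Sum>l\<in>UNIV. vec_nth (Z j) l * vec_nth \<gamma> l * vec_nth (Z k) l) + \<Lambda>"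

definition residual :: "nat \<Rightarrow> (nat \<Rightarrow> real ^ 'p) \<Rightarrow> real vec \<Rightarrow> real ^ 'p \<Rightarrow> real vec" where
  "residual d X Y \<beta> = Y - Matrix.vec d (\<lambda>j. inner (X j) \<beta>)"

text \<open>
  Meaningful for \<open>\<gamma>\<close> in the nonnegative orthant, where every \<open>\<Omega> i\<close> is positive definite and
  \<open>mat_inverse\<close> is not \<open>None\<close>. Elsewhere its value is irrelevant, since it is only ever used
  together with \<open>barrier\<close> or on the orthant.
\<close>

definition loss ::
  "nat \<Rightarrow> (nat \<Rightarrow> nat) \<Rightarrow> (nat \<Rightarrow> nat \<Rightarrow> real ^ 'p) \<Rightarrow> (nat \<Rightarrow> nat \<Rightarrow> real ^ 'q) \<Rightarrow>
   (nat \<Rightarrow> real vec) \<Rightarrow> (nat \<Rightarrow> real mat) \<Rightarrow> (real ^ 'p) \<times> (real ^ 'q) \<Rightarrow> real" where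
  "loss m n X Z Y \<Lambda> = (\<lambda>(\<beta>, \<gamma>). \<Sum>i = 1..m.
     (let r = residual (n i) (X i) (Y i) \<beta>; W = Omega (n i) (Z i) (\<Lambda> i) \<gamma>
      in 1 / 2 * (r \<bullet> (the (mat_inverse W) *\<^sub>v r)) + 1 / 2 * ln (Determinant.det W)))"

definition nonneg_orthant :: "(real ^ 'q) set" where
  "nonneg_orthant = {\<gamma>. \<forall>l. 0 \<le> vec_nth \<gamma> l}"

definition ind :: "'a set \<Rightarrow> 'a \<Rightarrow> ereal" where
  "ind C x = (if x \<in> C then 0 else \<infinity>)"

definition barrier :: "real \<Rightarrow> real ^ 'q \<Rightarrow> ereal" where
  "barrier \<mu> \<gamma> =
     (if \<mu> = 0 then ind nonneg_orthant \<gamma>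
      else if \<forall>l. vec_nth \<gamma> l > 0 then ereal (- \<mu> * (\<Sum>l\<in>UNIV. ln (vec_nth \<gamma> l / \<mu>)))
      else \<infinity>)"

definition penalized_loss ::
  "nat \<Rightarrow> (nat \<Rightarrow> nat) \<Rightarrow> (nat \<Rightarrow> nat \<Rightarrow> real ^ 'p) \<Rightarrow> (nat \<Rightarrow> nat \<Rightarrow> real ^ 'q) \<Rightarrow>
   (nat \<Rightarrow> real vec) \<Rightarrow> (nat \<Rightarrow> real mat) \<Rightarrow> real \<Rightarrow> real \<Rightarrow>
   ((real ^ 'p) \<times> (real ^ 'q)) \<times> ((real ^ 'p) \<times> (real ^ 'q)) \<Rightarrow> ereal" where
  "penalized_loss m n X Z Y \<Lambda> \<eta> \<mu> = (\<lambda>((\<beta>, \<gamma>), (\<beta>', \<gamma>')).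
     ereal (loss m n X Z Y \<Lambda> (\<beta>, \<gamma>)) + barrier \<mu> \<gamma> +
     ereal (\<eta> / 2 * ((norm (\<beta> - \<beta>'))\<^sup>2 + (norm (\<gamma> - \<gamma>'))\<^sup>2)))"

definition lower_semicont :: "('a::euclidean_space \<Rightarrow> ereal) \<Rightarrow> bool" where
  "lower_semicont f \<longleftrightarrow> (\<forall>x. f x \<le> Liminf (at x) f)"

definition level_compact :: "('a::euclidean_space \<Rightarrow> ereal) \<Rightarrow> bool" where
  "level_compact f \<longleftrightarrow>
     closed {(x, t::real). f x \<le> ereal t} \<and> (\<forall>\<nu>::real. bounded {x. f x \<le> ereal \<nu>})"

definition one_coercive :: "('a::euclidean_space \<Rightarrow> ereal) \<Rightarrow> bool" where
  "one_coercive f \<longleftrightarrow> Liminf at_infinity (\<lambda>x. f x / ereal (norm x)) > 0"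

text \<open>The optimal value \<open>\<infinity>\<close> is allowed; then every feasible point is optimal.\<close>

definition optimal_on :: "'a set \<Rightarrow> ('a \<Rightarrow> ereal) \<Rightarrow> 'a \<Rightarrow> bool" where
  "optimal_on C f x \<longleftrightarrow> x \<in> C \<and> f x = (INF y\<in>C. f y)"

definition cluster_point :: "(nat \<Rightarrow> 'a::topological_space) \<Rightarrow> 'a \<Rightarrow> bool" where
  "cluster_point s x \<longleftrightarrow> (\<exists>r::nat \<Rightarrow> nat. strict_mono r \<and> (s \<circ> r) \<longlonglongrightarrow> x)"

end

theory Submission
  imports Defs
begin

text \<open>
  The argument is the classical one for quadratic penalties. Write the penalized objective as
  \<open>f x + \<eta>/2 |x - y|\<^sup>2 + g y\<close>, where \<open>f\<close> is the loss plus the barrier and \<open>g\<close> is \<open>R\<close> plus the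
  indicator of the orthant. Both are lower semicontinuous and never \<open>-\<infinity>\<close>. Testing optimality with
  \<open>(u, u)\<close> and passing to the lower limit gives \<open>f a + g a \<le> f u + g u\<close> as soon as the two cluster
  points agree. They do agree even when \<open>f + g\<close> is identically \<open>\<infinity>\<close>, which happens if \<open>\<mu> > 0\<close> and \<open>R\<close>
  is finite only on the boundary of the orthant: for \<open>x0\<close> with \<open>g x0 < \<infinity>\<close> there are points \<open>y\<close> with
  \<open>f y < \<infinity>\<close> arbitrarily close to \<open>x0\<close>, and dividing the comparison with \<open>(y, x0)\<close> by \<open>\<eta>\<close> bounds the
  limiting distance by \<open>dist y x0\<close>.
\<close>

section \<open>Lower semicontinuity\<close>

text \<open>If \<open>c\<close> is a lower bound for \<open>Liminf F h\<close>, the truncation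
  \<open>min (h x) c\<close> converges to \<open>c\<close>, so bounds become limits. The truncated
  sum then converges to \<open>a + b\<close>, since extended addition is continuous there: neither
  term is \<open>-\<infinity>\<close>.\<close>

lemma add_le_Liminf:
  fixes f g :: "'a \<Rightarrow> ereal"
  assumes F: "F \<noteq> bot"
    and a: "a \<le> Liminf F f" "a \<noteq> -\<infinity>"
    and b: "b \<le> Liminf F g" "b \<noteq> -\<infinity>"
  shows "a + b \<le> Liminf F (\<lambda>x. f x + g x)"
proof -
  have trunc: "((\<lambda>x. min (h x) c) \<longlongrightarrow> c) F" if "c \<le> Liminf F h" for h :: "'a \<Rightarrow> ereal" and c
  proof (rule order_tendstoI)
    fix y assume "y < c"
    with that have "eventually (\<lambda>x. y < h x) F" by (simp add: le_Liminf_iff)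
    then show "eventually (\<lambda>x. y < min (h x) c) F"
      by eventually_elim (use \<open>y < c\<close> in simp)
  next
    fix y assume "c < y"
    then show "eventually (\<lambda>x. min (h x) c < y) F" by (simp add: min_less_iff_disj)
  qed
  have "((\<lambda>x. min (f x) a + min (g x) b) \<longlongrightarrow> a + b) F"
    by (intro tendsto_add_ereal_nonneg trunc a b)
  then have "a + b = Liminf F (\<lambda>x. min (f x) a + min (g x) b)"
    using F by (simp add: lim_imp_Liminf)
  also have "\<dots> \<le> Liminf F (\<lambda>x. f x + g x)"
    by (intro Liminf_mono always_eventually allI add_mono) auto
  finally show ?thesis .
qed

text \<open>The definition uses the punctured filter \<open>at x\<close>, but \<open>s\<close> may
  take the value \<open>x\<close>. There the required inequality is the assumption
  \<open>y < f x\<close> itself, so it holds on full neighbourhoods.\<close>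

lemma lower_semicont_le_Liminf:
  assumes "lower_semicont f" and s: "(s \<longlongrightarrow> x) F"
  shows "f x \<le> Liminf F (\<lambda>t. f (s t))"
  unfolding le_Liminf_iff
proof (intro allI impI)
  fix y assume y: "y < f x"
  with assms(1) have "eventually (\<lambda>z. y < f z) (at x)"
    by (auto simp: lower_semicont_def le_Liminf_iff)
  then have "eventually (\<lambda>z. y < f z) (nhds x)"
    unfolding eventually_at_filter by eventually_elim (use y in blast)
  with s show "eventually (\<lambda>t. y < f (s t)) F"
    by (rule eventually_compose_filterlim[rotated])
qed

text \<open>A real level fits strictly between \<open>y\<close> and \<open>f x\<close>, so the open
  complement of a real sublevel set serves as the neighbourhood.\<close>

lemma lower_semicontI_sublevel:
  fixes f :: "'a::euclidean_space \<Rightarrow> ereal"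
  assumes "\<And>c::real. closed {x. f x \<le> ereal c}"
  shows "lower_semicont f"
  unfolding lower_semicont_def le_Liminf_iff
proof (intro allI impI)
  fix x y assume "y < f x"
  then obtain c where c: "y < ereal c" "ereal c < f x" by (meson ereal_dense2)
  have "open (- {x. f x \<le> ereal c})" using assms by (simp add: open_Compl)
  moreover have "x \<in> - {x. f x \<le> ereal c}" using c by simp
  ultimately have "eventually (\<lambda>z. z \<in> - {x. f x \<le> ereal c}) (nhds x)"
    by (rule eventually_nhds_in_open)
  then show "eventually (\<lambda>z. y < f z) (at x)"
    unfolding eventually_at_filter
    by eventually_elim (use c in \<open>auto simp: not_le intro: less_trans\<close>)
qed

text \<open>Off \<open>S\<close> the value \<infinity> exceeds any \<open>y\<close> below
  \<open>f x\<close>, and closedness gives points outside \<open>S\<close> a neighbourhood of such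
  values. This suits the loss, whose continuity is available only along the orthant.\<close>

lemma lower_semicontI_within:
  fixes f :: "'a::euclidean_space \<Rightarrow> ereal"
  assumes S: "closed S" "\<And>x. x \<notin> S \<Longrightarrow> f x = \<infinity>"
    and lim: "\<And>x. x \<in> S \<Longrightarrow> f x \<le> Liminf (at x within S) f"
  shows "lower_semicont f"
  unfolding lower_semicont_def le_Liminf_iff
proof (intro allI impI)
  fix x y assume y: "y < f x"
  show "eventually (\<lambda>z. y < f z) (at x)"
  proof (cases "x \<in> S")
    case True
    with lim y have "eventually (\<lambda>z. y < f z) (at x within S)"
      by (auto simp: le_Liminf_iff)
    then show ?thesis
      unfolding eventually_at_filter
    proof eventually_elim
      case (elim z)
      then show ?case using S(2)[of z] y by (cases "z \<in> S") auto
    qed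
  next
    case False
    then have "eventually (\<lambda>z. z \<in> - S) (nhds x)"
      using S(1) by (intro eventually_nhds_in_open) auto
    then show ?thesis
      unfolding eventually_at_filter
      by eventually_elim (use S(2) False y in auto)
  qed
qed

lemma lower_semicont_comp:
  assumes "lower_semicont f" and h: "\<And>x. isCont h x"
  shows "lower_semicont (\<lambda>x. f (h x))"
  unfolding lower_semicont_def
  using h by (intro allI lower_semicont_le_Liminf[OF assms(1)]) (simp add: isCont_def)

lemma lower_semicont_add:
  fixes f g :: "'a::euclidean_space \<Rightarrow> ereal"
  assumes "lower_semicont f" "\<And>x. f x \<noteq> -\<infinity>" "lower_semicont g" "\<And>x. g x \<noteq> -\<infinity>"
  shows "lower_semicont (\<lambda>x. f x + g x)"
  using assms unfolding lower_semicont_def by (auto intro!: add_le_Liminf)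

section \<open>Indicator of the orthant and logarithmic barrier\<close>

lemma ind_neq_MInfty: "ind C x \<noteq> -\<infinity>"
  by (simp add: ind_def)

lemma lower_semicont_ind: "closed C \<Longrightarrow> lower_semicont (ind C)"
proof (rule lower_semicontI_sublevel)
  fix c :: real
  assume C: "closed C"
  have "{x. ind C x \<le> ereal c} = (if 0 \<le> c then C else {})"
    by (auto simp: ind_def split: if_splits)
  then show "closed {x. ind C x \<le> ereal c}" using C by simp
qed

lemma nonneg_orthant_altdef: "nonneg_orthant = (\<Inter>l. {\<gamma>. 0 \<le> vec_nth \<gamma> l})"
  by (auto simp: nonneg_orthant_def)

lemma closed_nonneg_orthant: "closed nonneg_orthant"
  unfolding nonneg_orthant_altdef
  by (intro closed_INT ballI closed_Collect_le continuous_intros)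

text \<open>
  The product form shows that the sublevel sets of the barrier are closed up to the boundary of the
  orthant, where the logarithms have junk values.
\<close>

lemma barrier_le_iff:
  assumes "\<mu> > 0"
  shows "barrier \<mu> \<gamma> \<le> ereal c \<longleftrightarrow>
    \<gamma> \<in> nonneg_orthant \<and> exp (- c / \<mu>) \<le> (\<Prod>l\<in>UNIV. vec_nth \<gamma> l / \<mu>)"
proof (cases "\<forall>l. vec_nth \<gamma> l > 0")
  case True
  let ?P = "\<Prod>l\<in>UNIV. vec_nth \<gamma> l / \<mu>"
  have "?P > 0" using True assms by (intro prod_pos) auto
  have "(\<Sum>l\<in>UNIV. ln (vec_nth \<gamma> l / \<mu>)) = ln ?P"
    using True assms by (subst ln_prod) (auto simp: less_imp_neq[symmetric])
  then have "barrier \<mu> \<gamma> \<le> ereal c \<longleftrightarrow> - c / \<mu> \<le> ln ?P"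
    using True assms by (auto simp: barrier_def field_simps)
  also have "\<dots> \<longleftrightarrow> exp (- c / \<mu>) \<le> ?P"
    using \<open>?P > 0\<close> by (simp add: ln_ge_iff)
  finally show ?thesis using True by (auto simp: nonneg_orthant_def intro: less_imp_le)
next
  case False
  then obtain l where l: "vec_nth \<gamma> l \<le> 0" by (auto simp: not_less)
  have "\<not> exp (- c / \<mu>) \<le> (\<Prod>l\<in>UNIV. vec_nth \<gamma> l / \<mu>)" if "\<gamma> \<in> nonneg_orthant"
  proof -
    have "vec_nth \<gamma> l = 0" using that l by (auto simp: nonneg_orthant_def intro: antisym)
    then have "(\<Prod>l\<in>UNIV. vec_nth \<gamma> l / \<mu>) = 0"
      by (intro prod_zero bexI[of _ l]) auto
    then show ?thesis by (simp only: not_le exp_gt_zero)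
  qed
  then show ?thesis using False assms by (auto simp: barrier_def)
qed

lemma lower_semicont_barrier:
  assumes "\<mu> \<ge> 0"
  shows "lower_semicont (barrier \<mu> :: real ^ 'q \<Rightarrow> ereal)"
proof (cases "\<mu> = 0")
  case True
  then have "(barrier \<mu> :: real ^ 'q \<Rightarrow> ereal) = ind nonneg_orthant" by (auto simp: barrier_def)
  then show ?thesis using lower_semicont_ind[OF closed_nonneg_orthant] by simp
next
  case False
  with assms have \<mu>: "\<mu> > 0" by simp
  show ?thesis
  proof (rule lower_semicontI_sublevel)
    fix c :: real
    have "closed (nonneg_orthant \<inter> {\<gamma>::real ^ 'q. exp (- c / \<mu>) \<le> (\<Prod>l\<in>UNIV. vec_nth \<gamma> l / \<mu>)})"
      using \<mu> by (intro closed_Int closed_nonneg_orthant closed_Collect_le continuous_intros) auto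
    then show "closed {\<gamma> :: real ^ 'q. barrier \<mu> \<gamma> \<le> ereal c}"
      by (simp add: barrier_le_iff[OF \<mu>] Collect_conj_eq)
  qed
qed

lemma barrier_neq_MInfty: "barrier \<mu> \<gamma> \<noteq> -\<infinity>"
  by (auto simp: barrier_def ind_def)

lemma barrier_outside: "\<gamma> \<notin> nonneg_orthant \<Longrightarrow> barrier \<mu> \<gamma> = \<infinity>"
  by (auto simp: barrier_def ind_def nonneg_orthant_def intro: less_imp_le)

lemma barrier_finite: "(\<And>l. vec_nth \<gamma> l > 0) \<Longrightarrow> barrier \<mu> \<gamma> < \<infinity>"
  by (auto simp: barrier_def ind_def nonneg_orthant_def intro: less_imp_le)

section \<open>Continuity of the loss on the orthant\<close>

text \<open>By the Leibniz formula the determinant is a polynomial in the entries.\<close>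

lemma tendsto_det:
  fixes A :: "'a \<Rightarrow> real mat"
  assumes A: "\<And>t. A t \<in> carrier_mat d d" and B: "B \<in> carrier_mat d d"
    and lim: "\<And>i j. i < d \<Longrightarrow> j < d \<Longrightarrow> ((\<lambda>t. A t $$ (i, j)) \<longlongrightarrow> B $$ (i, j)) F"
  shows "((\<lambda>t. Determinant.det (A t)) \<longlongrightarrow> Determinant.det B) F"
  unfolding Determinant.det_def'[OF A] Determinant.det_def'[OF B]
  by (intro tendsto_sum tendsto_mult tendsto_const tendsto_prod lim)
     (auto simp: permutes_in_image dest: permutes_in_image)

lemma tendsto_cofactor:
  fixes A :: "'a \<Rightarrow> real mat"
  assumes A: "\<And>t. A t \<in> carrier_mat d d" and B: "B \<in> carrier_mat d d"
    and lim: "\<And>i j. i < d \<Longrightarrow> j < d \<Longrightarrow> ((\<lambda>t. A t $$ (i, j)) \<longlongrightarrow> B $$ (i, j)) F"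
  shows "((\<lambda>t. cofactor (A t) i j) \<longlongrightarrow> cofactor B i j) F"
  unfolding Determinant.cofactor_def
proof (intro tendsto_mult tendsto_const tendsto_det)
  show "mat_delete (A t) i j \<in> carrier_mat (d - 1) (d - 1)" for t
    by (rule mat_delete_carrier[OF A])
  show "mat_delete B i j \<in> carrier_mat (d - 1) (d - 1)"
    by (rule mat_delete_carrier[OF B])
  fix i' j' assume "i' < d - 1" "j' < d - 1"
  moreover have "dim_row (A t) = d" "dim_col (A t) = d" for t using A by auto
  moreover have "dim_row B = d" "dim_col B = d" using B by auto
  ultimately show "((\<lambda>t. mat_delete (A t) i j $$ (i', j')) \<longlongrightarrow> mat_delete B i j $$ (i', j')) F"
    unfolding mat_delete_def by (auto intro!: lim)
qed

text \<open>The adjugate identities make the scaled adjugate a two-sided inverse. Hence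
  \<open>A\<close> is a unit of the matrix ring, which excludes the result \<open>None\<close>, and
  inverses are unique.\<close>

lemma mat_inverse_eq_adj_mat:
  fixes A :: "'a::field mat"
  assumes A: "A \<in> carrier_mat d d" and det: "Determinant.det A \<noteq> 0"
  shows "the (mat_inverse A) = inverse (Determinant.det A) \<cdot>\<^sub>m adj_mat A"
proof -
  let ?C = "inverse (Determinant.det A) \<cdot>\<^sub>m adj_mat A"
  note adj = adj_mat[OF A]
  have C: "?C \<in> carrier_mat d d" using adj by simp
  have unit: "inverse (Determinant.det A) \<cdot>\<^sub>m (Determinant.det A \<cdot>\<^sub>m 1\<^sub>m d) = 1\<^sub>m d"
    using det by (intro eq_matI) auto
  have AC: "A * ?C = 1\<^sub>m d"
    by (simp add: mult_smult_distrib[OF A adj(1)] adj(2) unit)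
  have CA: "?C * A = 1\<^sub>m d"
    by (simp add: mult_smult_assoc_mat[OF adj(1) A] adj(3) unit)
  have "A \<in> Units (ring_mat TYPE('a) d undefined)"
    using A C AC CA by (auto simp: Units_def ring_mat_def)
  then obtain B where B: "mat_inverse A = Some B"
    using mat_inverse(1)[OF A, where b = undefined] by (cases "mat_inverse A") auto
  from mat_inverse(2)[OF A B] have B': "B * A = 1\<^sub>m d" "B \<in> carrier_mat d d" by auto
  have "B = B * (A * ?C)" using AC B' by simp
  also have "\<dots> = (B * A) * ?C" by (rule assoc_mult_mat[OF B'(2) A C, symmetric])
  also have "\<dots> = ?C" by (simp only: B'(1) left_mult_one_mat[OF C])
  finally show ?thesis using B by simp
qed

text \<open>Turns the inverse into a rational expression in the entries, from which continuity can
  be read off. The swapped indices of the cofactor come from the transpose in the adjugate.\<close>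

lemma quadratic_form_mat_inverse:
  fixes A :: "'a::field mat"
  assumes A: "A \<in> carrier_mat d d" and det: "Determinant.det A \<noteq> 0" and r: "r \<in> carrier_vec d"
  shows "r \<bullet> (the (mat_inverse A) *\<^sub>v r) =
    inverse (Determinant.det A) * (\<Sum>i<d. \<Sum>j<d. r $ i * cofactor A j i * r $ j)"
proof -
  have dims: "dim_row A = d" "dim_col A = d" "dim_vec r = d" using A r by auto
  show ?thesis
    unfolding mat_inverse_eq_adj_mat[OF A det]
    using dims
    by (simp add: scalar_prod_def mult_mat_vec_def adj_mat_def atLeast0LessThan
        sum_distrib_left sum_distrib_right mult_ac)
qed

section \<open>The matrices \<open>Omega\<close> and the loss on the orthant\<close>

lemma Omega_carrier: "\<Lambda> \<in> carrier_mat d d \<Longrightarrow> Omega d Z \<Lambda> \<gamma> \<in> carrier_mat d d"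
  by (simp add: Omega_def)

lemma Omega_index:
  assumes "\<Lambda> \<in> carrier_mat d d" "j < d" "k < d"
  shows "Omega d Z \<Lambda> \<gamma> $$ (j, k) =
    (\<Sum>l\<in>UNIV. vec_nth (Z j) l * vec_nth \<gamma> l * vec_nth (Z k) l) + \<Lambda> $$ (j, k)"
  using assms by (simp add: Omega_def)

lemma Omega_quadratic_form:
  fixes \<gamma> :: "real ^ 'q"
  assumes \<Lambda>: "\<Lambda> \<in> carrier_mat d d" and v: "v \<in> carrier_vec d"
  shows "v \<bullet> (Omega d Z \<Lambda> \<gamma> *\<^sub>v v) =
    (\<Sum>l\<in>UNIV. vec_nth \<gamma> l * (\<Sum>j<d. v $ j * vec_nth (Z j) l)\<^sup>2) + v \<bullet> (\<Lambda> *\<^sub>v v)"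
proof -
  have form: "v \<bullet> (A *\<^sub>v v) = (\<Sum>j<d. \<Sum>k<d. v $ j * A $$ (j, k) * v $ k)"
    if "A \<in> carrier_mat d d" for A
    using that v by (simp add: scalar_prod_def mult_mat_vec_def atLeast0LessThan sum_distrib_left mult_ac)
  have "v \<bullet> (Omega d Z \<Lambda> \<gamma> *\<^sub>v v) =
      (\<Sum>j<d. \<Sum>k<d. \<Sum>l\<in>UNIV. vec_nth \<gamma> l * ((v $ j * vec_nth (Z j) l) * (v $ k * vec_nth (Z k) l)))
      + (\<Sum>j<d. \<Sum>k<d. v $ j * \<Lambda> $$ (j, k) * v $ k)"
    unfolding form[OF Omega_carrier[OF \<Lambda>]] sum.distrib[symmetric]
    by (intro sum.cong refl)
       (simp add: Omega_index[OF \<Lambda>] distrib_left distrib_right sum_distrib_left sum_distrib_right mult_ac)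
  \<comment> \<open>With the sum over \<open>l\<close> outermost, each inner double sum factors into
    the square of the \<open>l\<close>-th coordinate of the transpose of \<open>Z\<close> applied to
    \<open>v\<close>.\<close>
  also have "(\<Sum>j<d. \<Sum>k<d. \<Sum>l\<in>UNIV. vec_nth \<gamma> l * ((v $ j * vec_nth (Z j) l) * (v $ k * vec_nth (Z k) l)))
      = (\<Sum>l\<in>UNIV. \<Sum>j<d. \<Sum>k<d. vec_nth \<gamma> l * ((v $ j * vec_nth (Z j) l) * (v $ k * vec_nth (Z k) l)))"
    by (simp only: sum.swap[where A = "{..<d}" and B = "UNIV :: 'q set"])
  also have "\<dots> = (\<Sum>l\<in>UNIV. vec_nth \<gamma> l * (\<Sum>j<d. v $ j * vec_nth (Z j) l)\<^sup>2)"
    by (rule sum.cong[OF refl], subst power2_eq_square, subst sum_product)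
       (simp only: sum_distrib_left)
  finally show ?thesis by (simp add: form[OF \<Lambda>])
qed

text \<open>On a nonzero kernel vector the quadratic form would vanish, yet it is at least that of
  \<open>\<Lambda>\<close>, which is positive. Nonvanishing is what the limit rules for inverse and
  logarithm ask for.\<close>

lemma det_Omega_nonzero:
  assumes \<Lambda>: "sym_pos_def d \<Lambda>" and \<gamma>: "\<gamma> \<in> nonneg_orthant"
  shows "Determinant.det (Omega d Z \<Lambda> \<gamma>) \<noteq> 0"
proof
  have C: "\<Lambda> \<in> carrier_mat d d" using \<Lambda> by (simp add: sym_pos_def_def)
  assume "Determinant.det (Omega d Z \<Lambda> \<gamma>) = 0"
  then obtain v where v: "v \<in> carrier_vec d" "v \<noteq> 0\<^sub>v d" "Omega d Z \<Lambda> \<gamma> *\<^sub>v v = 0\<^sub>v d"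
    using det_0_iff_vec_prod_zero_field[OF Omega_carrier[OF C]] by blast
  then have "v \<bullet> (Omega d Z \<Lambda> \<gamma> *\<^sub>v v) = 0" by simp
  moreover have "v \<bullet> (\<Lambda> *\<^sub>v v) > 0" using \<Lambda> v by (simp add: sym_pos_def_def)
  moreover have "(\<Sum>l\<in>UNIV. vec_nth \<gamma> l * (\<Sum>j<d. v $ j * vec_nth (Z j) l)\<^sup>2) \<ge> 0"
    using \<gamma> by (intro sum_nonneg) (auto simp: nonneg_orthant_def)
  ultimately show False unfolding Omega_quadratic_form[OF C v(1)] by linarith
qed

lemma continuous_on_loss:
  assumes Y: "\<And>i. i \<in> {1..m} \<Longrightarrow> Y i \<in> carrier_vec (n i)"
    and \<Lambda>: "\<And>i. i \<in> {1..m} \<Longrightarrow> sym_pos_def (n i) (\<Lambda> i)"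
  shows "continuous_on (UNIV \<times> nonneg_orthant) (loss m n X Z Y \<Lambda>)"
proof -
  let ?W = "\<lambda>i v. Omega (n i) (Z i) (\<Lambda> i) (snd v)"
  let ?r = "\<lambda>i v. residual (n i) (X i) (Y i) (fst v)"
  let ?g = "\<lambda>v. \<Sum>i = 1..m. 1 / 2 * (inverse (Determinant.det (?W i v)) *
      (\<Sum>a<n i. \<Sum>b<n i. ?r i v $ a * cofactor (?W i v) b a * ?r i v $ b))
      + 1 / 2 * ln (Determinant.det (?W i v))"
  have C: "\<Lambda> i \<in> carrier_mat (n i) (n i)" if "i \<in> {1..m}" for i
    using \<Lambda>[OF that] by (simp add: sym_pos_def_def)
  have "continuous_on (UNIV \<times> nonneg_orthant) ?g"
    unfolding continuous_on_def
  proof (intro ballI tendsto_sum tendsto_add tendsto_mult tendsto_const tendsto_inverse tendsto_ln)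
    fix v :: "(real ^ 'a) \<times> (real ^ 'b)" and i
    assume v: "v \<in> UNIV \<times> nonneg_orthant" and i: "i \<in> {1..m}"
    let ?F = "at v within UNIV \<times> nonneg_orthant"
    have W: "((\<lambda>v. ?W i v $$ (j, k)) \<longlongrightarrow> ?W i v $$ (j, k)) ?F" if "j < n i" "k < n i" for j k
      unfolding Omega_index[OF C[OF i] that] by (intro tendsto_intros)
    note W' = Omega_carrier[OF C[OF i]] Omega_carrier[OF C[OF i]]
    show "((\<lambda>v. Determinant.det (?W i v)) \<longlongrightarrow> Determinant.det (?W i v)) ?F"
      by (rule tendsto_det[OF W' W])
    \<comment> \<open>The determinant enters \<open>?g\<close> both inverted and under the
      logarithm, so its limit and its nonvanishing are each demanded twice. The residual likewise
      occurs as two factors.\<close>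
    then show "((\<lambda>v. Determinant.det (?W i v)) \<longlongrightarrow> Determinant.det (?W i v)) ?F" .
    show nz: "Determinant.det (?W i v) \<noteq> 0"
      using v by (intro det_Omega_nonzero \<Lambda> i) auto
    then show "Determinant.det (?W i v) \<noteq> 0" .
    show "((\<lambda>v. cofactor (?W i v) b a) \<longlongrightarrow> cofactor (?W i v) b a) ?F" for a b
      by (rule tendsto_cofactor[OF W' W])
    show "((\<lambda>v. ?r i v $ a) \<longlongrightarrow> ?r i v $ a) ?F" if "a \<in> {..<n i}" for a
      using that Y[OF i] by (auto simp: residual_def intro!: tendsto_intros)
    then show "((\<lambda>v. ?r i v $ a) \<longlongrightarrow> ?r i v $ a) ?F" if "a \<in> {..<n i}" for a
      using that .
  qed
  moreover have "loss m n X Z Y \<Lambda> v = ?g v" if "v \<in> UNIV \<times> nonneg_orthant" for v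
    unfolding loss_def Let_def case_prod_beta
  proof (intro sum.cong refl arg_cong2[where f = "(+)"] arg_cong2[where f = "(*)"] quadratic_form_mat_inverse)
    fix i assume i: "i \<in> {1..m}"
    show "?W i v \<in> carrier_mat (n i) (n i)" by (rule Omega_carrier[OF C[OF i]])
    show "Determinant.det (?W i v) \<noteq> 0" using that by (intro det_Omega_nonzero \<Lambda> i) auto
    show "?r i v \<in> carrier_vec (n i)" using Y[OF i] by (simp add: residual_def)
  qed
  ultimately show ?thesis by (simp cong: continuous_on_cong)
qed

lemma lower_semicont_loss_barrier:
  assumes "\<And>i. i \<in> {1..m} \<Longrightarrow> Y i \<in> carrier_vec (n i)"
    and "\<And>i. i \<in> {1..m} \<Longrightarrow> sym_pos_def (n i) (\<Lambda> i)" and "\<mu> \<ge> 0"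
  shows "lower_semicont (\<lambda>v. ereal (loss m n X Z Y \<Lambda> v) + barrier \<mu> (snd v))"
proof (rule lower_semicontI_within[where S = "UNIV \<times> nonneg_orthant"])
  show "closed (UNIV \<times> nonneg_orthant :: ((real ^ 'a) \<times> (real ^ 'b)) set)"
    by (intro closed_Times closed_nonneg_orthant) simp
  show "ereal (loss m n X Z Y \<Lambda> v) + barrier \<mu> (snd v) = \<infinity>"
    if "v \<notin> UNIV \<times> nonneg_orthant" for v
  proof -
    have "snd v \<notin> nonneg_orthant" using that by (cases v) auto
    then show ?thesis by (simp add: barrier_outside)
  qed
  fix v :: "(real ^ 'a) \<times> (real ^ 'b)"
  assume v: "v \<in> UNIV \<times> nonneg_orthant"
  let ?F = "at v within UNIV \<times> nonneg_orthant"
  show "ereal (loss m n X Z Y \<Lambda> v) + barrier \<mu> (snd v)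
    \<le> Liminf ?F (\<lambda>v. ereal (loss m n X Z Y \<Lambda> v) + barrier \<mu> (snd v))"
  \<comment> \<open>Along the trivial filter every lower limit is \<infinity>;
    \<open>lim_imp_Liminf\<close> and \<open>add_le_Liminf\<close> need a nontrivial one.\<close>
  proof (cases "?F = bot")
    case True
    then show ?thesis by simp
  next
    case False
    have "((\<lambda>v. ereal (loss m n X Z Y \<Lambda> v)) \<longlongrightarrow> ereal (loss m n X Z Y \<Lambda> v)) ?F"
      using continuous_on_loss[of m Y n \<Lambda> X Z, OF assms(1,2)] v
      by (auto simp: continuous_on_def)
    then have "ereal (loss m n X Z Y \<Lambda> v) = Liminf ?F (\<lambda>v. ereal (loss m n X Z Y \<Lambda> v))"
      by (rule lim_imp_Liminf[OF False, symmetric])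
    moreover have "barrier \<mu> (snd v) \<le> Liminf ?F (\<lambda>v. barrier \<mu> (snd v))"
      by (rule lower_semicont_le_Liminf[OF lower_semicont_barrier[OF assms(3)]])
         (intro tendsto_intros)
    ultimately show ?thesis
      using False by (intro add_le_Liminf barrier_neq_MInfty) auto
  qed
qed

section \<open>The quadratic penalty\<close>

text \<open>Stated for convergent sequences, so that a cluster point enters through a subsequence.
  Finiteness of \<open>f\<close> is required near \<open>x0\<close> rather than at it, which leaves
  room for \<open>f + g\<close> to be \<infinity> everywhere.\<close>

lemma quadratic_penalty_cluster_point:
  fixes f g :: "'a::euclidean_space \<Rightarrow> ereal" and \<eta> :: "nat \<Rightarrow> real"
  assumes f: "lower_semicont f" "\<And>x. f x \<noteq> -\<infinity>"
    and g: "lower_semicont g" "\<And>x. g x \<noteq> -\<infinity>"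
    and x0: "g x0 < \<infinity>" "\<And>e. e > 0 \<Longrightarrow> \<exists>y. dist y x0 < e \<and> f y < \<infinity>"
    and \<eta>: "\<And>k. \<eta> k > 0" "filterlim \<eta> at_top sequentially"
    and opt: "\<And>k y z. f (w k) + ereal (\<eta> k / 2 * (dist (w k) (w' k))\<^sup>2) + g (w' k)
      \<le> f y + ereal (\<eta> k / 2 * (dist y z)\<^sup>2) + g z"
    and lim: "w \<longlonglongrightarrow> a" "w' \<longlonglongrightarrow> b"
  shows "a = b" and "f a + g a \<le> f u + g u"
proof -
  \<comment> \<open>No global lower bounds are assumed; semicontinuity at the limits makes
    \<open>D\<close> and \<open>E\<close> eventual real lower bounds along the sequences.\<close>
  obtain D where D: "ereal D < f a" using f(2)[of a] ereal_dense2[of "-\<infinity>" "f a"] by auto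
  obtain E where E: "ereal E < g b" using g(2)[of b] ereal_dense2[of "-\<infinity>" "g b"] by auto
  have fa: "f a \<le> liminf (\<lambda>k. f (w k))" and gb: "g b \<le> liminf (\<lambda>k. g (w' k))"
    using lower_semicont_le_Liminf f(1) g(1) lim by blast+
  have evD: "eventually (\<lambda>k. ereal D < f (w k)) sequentially"
    and evE: "eventually (\<lambda>k. ereal E < g (w' k)) sequentially"
    using fa gb D E by (auto simp: le_Liminf_iff)
  have "dist a b \<le> e" if e: "e > 0" for e
  proof -
    obtain y where y: "dist y x0 < e" "f y < \<infinity>" using x0(2)[OF e] by blast
    obtain c where c: "f y = ereal c" using y f(2)[of y] by (cases "f y") auto
    obtain d where d: "g x0 = ereal d" using x0 g(2)[of x0] by (cases "g x0") auto
    \<comment> \<open>The comparison with \<open>(y, x0)\<close> is multiplied by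
      \<open>2 / \<eta> k\<close>, so the finite values and bounds end up in a term that tends to
      0.\<close>
    have "eventually (\<lambda>k. (dist (w k) (w' k))\<^sup>2 \<le> e\<^sup>2 + 2 * (c + d - D - E) * inverse (\<eta> k)) sequentially"
      using evD evE
    proof eventually_elim
      case (elim k)
      have "f (w k) + ereal (\<eta> k / 2 * (dist (w k) (w' k))\<^sup>2) + g (w' k)
          \<le> ereal (c + \<eta> k / 2 * (dist y x0)\<^sup>2 + d)"
        using opt[of k y x0] c d by simp
      \<comment> \<open>Extended reals do not cancel freely, and \<open>f (w k)\<close> or
        \<open>g (w' k)\<close> is not yet known to be finite. Replacing them by \<open>D\<close>
        and \<open>E\<close> leaves an inequality between reals.\<close>
      moreover have "ereal (D + \<eta> k / 2 * (dist (w k) (w' k))\<^sup>2 + E)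
          \<le> f (w k) + ereal (\<eta> k / 2 * (dist (w k) (w' k))\<^sup>2) + g (w' k)"
        unfolding plus_ereal.simps(1)[symmetric]
        using elim by (intro add_mono) auto
      ultimately have "ereal (D + \<eta> k / 2 * (dist (w k) (w' k))\<^sup>2 + E)
          \<le> ereal (c + \<eta> k / 2 * (dist y x0)\<^sup>2 + d)"
        by (rule order_trans[rotated])
      then have "D + \<eta> k / 2 * (dist (w k) (w' k))\<^sup>2 + E \<le> c + \<eta> k / 2 * (dist y x0)\<^sup>2 + d"
        by simp
      moreover have "\<eta> k / 2 * (dist y x0)\<^sup>2 \<le> \<eta> k / 2 * e\<^sup>2"
        using y(1) \<eta>(1)[of k] by (intro mult_left_mono power_mono) auto
      ultimately have "\<eta> k / 2 * (dist (w k) (w' k))\<^sup>2 \<le> \<eta> k / 2 * e\<^sup>2 + (c + d - D - E)"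
        by linarith
      then show ?case using \<eta>(1)[of k] by (simp add: field_simps)
    qed
    moreover have "(\<lambda>k. (dist (w k) (w' k))\<^sup>2) \<longlonglongrightarrow> (dist a b)\<^sup>2"
      by (intro tendsto_intros lim)
    moreover have "(\<lambda>k. e\<^sup>2 + 2 * (c + d - D - E) * inverse (\<eta> k)) \<longlonglongrightarrow> e\<^sup>2 + 2 * (c + d - D - E) * 0"
      by (intro tendsto_intros tendsto_inverse_0_at_top \<eta>(2))
    ultimately have "(dist a b)\<^sup>2 \<le> e\<^sup>2"
      using tendsto_le[OF sequentially_bot] by fastforce
    then show ?thesis using e by (simp add: power2_le_iff_abs_le)
  qed
  then have "dist a b \<le> 0" by (rule field_le_epsilon) simp
  then show ab: "a = b" by simp
  have "f (w k) + g (w' k) \<le> f u + g u" for k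
  proof -
    have "f (w k) + 0 + g (w' k) \<le> f (w k) + ereal (\<eta> k / 2 * (dist (w k) (w' k))\<^sup>2) + g (w' k)"
      using \<eta>(1)[of k] by (intro add_mono) auto
    also have "\<dots> \<le> f u + g u" using opt[of k u u] by simp
    finally show ?thesis by simp
  qed
  then have "liminf (\<lambda>k. f (w k) + g (w' k)) \<le> f u + g u"
    using Liminf_mono[of "\<lambda>k. f (w k) + g (w' k)" "\<lambda>_. f u + g u" sequentially]
    by (simp add: Liminf_const)
  moreover have "f a + g b \<le> liminf (\<lambda>k. f (w k) + g (w' k))"
    by (intro add_le_Liminf fa gb f g) simp
  ultimately show "f a + g a \<le> f u + g u" using ab by simp
qed

section \<open>Application to the loss, the barrier and the regularizer\<close>

theorem theorem6:
  fixes m :: nat and n :: "nat \<Rightarrow> nat"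
    and X :: "nat \<Rightarrow> nat \<Rightarrow> real ^ 'p" and Z :: "nat \<Rightarrow> nat \<Rightarrow> real ^ 'q"
    and Y :: "nat \<Rightarrow> real vec" and \<Lambda> :: "nat \<Rightarrow> real mat"
    and \<mu> :: real and \<eta> :: "nat \<Rightarrow> real"
    and R :: "(real ^ 'p) \<times> (real ^ 'q) \<Rightarrow> ereal"
    and w w' :: "nat \<Rightarrow> (real ^ 'p) \<times> (real ^ 'q)"
    and wbar what :: "(real ^ 'p) \<times> (real ^ 'q)"
  assumes "m \<ge> 1"
    and "\<And>i. i \<in> {1..m} \<Longrightarrow> n i \<ge> 1"
    and "\<And>i. i \<in> {1..m} \<Longrightarrow> Y i \<in> carrier_vec (n i)"
    and "\<And>i. i \<in> {1..m} \<Longrightarrow> sym_pos_def (n i) (\<Lambda> i)"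
    and "\<mu> \<ge> 0"
    and "\<And>v. R v \<ge> 0"
    and "lower_semicont R"
    and "\<exists>\<beta>. \<exists>\<gamma> \<in> nonneg_orthant. R (\<beta>, \<gamma>) < \<infinity>"
    and "\<mu> = 0 \<Longrightarrow> level_compact R"
    and "\<mu> > 0 \<Longrightarrow> one_coercive R"
    and "\<And>k. \<eta> k > 0"
    and "\<And>k. \<eta> k < \<eta> (Suc k)"
    and "filterlim \<eta> at_top sequentially"
    and "\<And>k. optimal_on UNIV
           (\<lambda>(v, v'). penalized_loss m n X Z Y \<Lambda> (\<eta> k) \<mu> (v, v') + R v' + ind nonneg_orthant (snd v'))
           (w k, w' k)"
    and "cluster_point (\<lambda>k. (w k, w' k)) (wbar, what)"
  shows "wbar = what \<and>
    optimal_on (UNIV \<times> nonneg_orthant)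
      (\<lambda>(\<beta>, \<gamma>). ereal (loss m n X Z Y \<Lambda> (\<beta>, \<gamma>)) + barrier \<mu> \<gamma> + R (\<beta>, \<gamma>)) wbar"
proof -
  let ?f = "\<lambda>v. ereal (loss m n X Z Y \<Lambda> v) + barrier \<mu> (snd v)"
  let ?g = "\<lambda>v. R v + ind nonneg_orthant (snd v)"
  have R: "R v \<noteq> -\<infinity>" for v using assms(6)[of v] by auto
  have f: "lower_semicont ?f" "?f v \<noteq> -\<infinity>" for v
    using lower_semicont_loss_barrier[OF assms(3-5)] barrier_neq_MInfty[of \<mu> "snd v"] by auto
  have g: "lower_semicont ?g" "?g v \<noteq> -\<infinity>" for v
    using lower_semicont_add[OF assms(7) R
        lower_semicont_comp[OF lower_semicont_ind[OF closed_nonneg_orthant], of snd] ind_neq_MInfty]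
      R[of v] ind_neq_MInfty[of nonneg_orthant "snd v"]
    by auto
  obtain \<beta> \<gamma> where x0: "\<gamma> \<in> nonneg_orthant" "R (\<beta>, \<gamma>) < \<infinity>" using assms(8) by blast
  have near: "\<exists>y. dist y (\<beta>, \<gamma>) < e \<and> ?f y < \<infinity>" if "e > 0" for e
  proof (intro exI conjI)
    \<comment> \<open>A shift along the all-ones vector makes every coordinate positive and hence
      the barrier finite. The extra 1 in the denominator keeps the displacement strictly below
      \<open>e\<close>.\<close>
    let ?\<delta> = "e / (1 + norm (1 :: real ^ 'q))"
    let ?y = "(\<beta>, \<gamma> + ?\<delta> *\<^sub>R 1)"
    have pos: "1 + norm (1 :: real ^ 'q) > 0" by (simp add: add_pos_nonneg)
    have \<delta>: "?\<delta> > 0" using that pos by simp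
    have "dist ?y (\<beta>, \<gamma>) = ?\<delta> * norm (1 :: real ^ 'q)"
      using \<delta> that by (simp add: dist_prod_def dist_norm)
    also have "\<dots> < e" using that pos by (simp add: field_simps)
    finally show "dist ?y (\<beta>, \<gamma>) < e" .
    have "barrier \<mu> (snd ?y) < \<infinity>"
      using x0(1) \<delta> by (intro barrier_finite) (simp add: nonneg_orthant_def add_nonneg_pos)
    then show "?f ?y < \<infinity>" by simp
  qed
  have pen: "penalized_loss m n X Z Y \<Lambda> (\<eta> k) \<mu> (v, v') + R v' + ind nonneg_orthant (snd v')
      = ?f v + ereal (\<eta> k / 2 * (dist v v')\<^sup>2) + ?g v'" for k v v'
    by (cases v; cases v') (simp add: penalized_loss_def dist_prod_def dist_norm add.assoc)
  have opt: "?f (w k) + ereal (\<eta> k / 2 * (dist (w k) (w' k))\<^sup>2) + ?g (w' k)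
      \<le> ?f y + ereal (\<eta> k / 2 * (dist y z)\<^sup>2) + ?g z" for k y z
  proof -
    have "penalized_loss m n X Z Y \<Lambda> (\<eta> k) \<mu> (w k, w' k) + R (w' k) + ind nonneg_orthant (snd (w' k))
        \<le> penalized_loss m n X Z Y \<Lambda> (\<eta> k) \<mu> (y, z) + R z + ind nonneg_orthant (snd z)"
      using assms(14)[of k] INF_lower[of "(y, z)" UNIV
          "\<lambda>(v, v'). penalized_loss m n X Z Y \<Lambda> (\<eta> k) \<mu> (v, v') + R v' + ind nonneg_orthant (snd v')"]
      by (simp add: optimal_on_def)
    then show ?thesis unfolding pen .
  qed
  \<comment> \<open>Feasibility of the limit cannot be inferred from its objective value, which may
    be \<infinity>. It is inherited from the iterates by closedness of the orthant; these are
    feasible because the penalized problem has a competitor of finite value.\<close>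
  have orthant: "snd (w' k) \<in> nonneg_orthant" for k
  proof (rule ccontr)
    assume "snd (w' k) \<notin> nonneg_orthant"
    then have "?f (w k) + ereal (\<eta> k / 2 * (dist (w k) (w' k))\<^sup>2) + ?g (w' k) = \<infinity>"
      by (simp add: ind_def)
    moreover obtain y where "?f y < \<infinity>" using near[of 1] by auto
    ultimately show False
      using opt[of k y "(\<beta>, \<gamma>)"] x0 by (auto simp: ind_def)
  qed
  obtain r :: "nat \<Rightarrow> nat" where r: "strict_mono r"
    and conv: "((\<lambda>k. (w k, w' k)) \<circ> r) \<longlonglongrightarrow> (wbar, what)"
    using assms(15) by (auto simp: cluster_point_def)
  from conv have lim: "(\<lambda>k. w (r k)) \<longlonglongrightarrow> wbar" "(\<lambda>k. w' (r k)) \<longlonglongrightarrow> what"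
    using tendsto_fst[OF conv] tendsto_snd[OF conv] by (simp_all add: o_def)
  have \<eta>: "filterlim (\<lambda>k. \<eta> (r k)) at_top sequentially"
    by (rule filterlim_compose[OF assms(13) filterlim_subseq[OF r]])
  have g0: "?g (\<beta>, \<gamma>) < \<infinity>" using x0 by (simp add: ind_def)
  note penalty = quadratic_penalty_cluster_point[where \<eta> = "\<lambda>k. \<eta> (r k)",
      OF f g g0 near assms(11) \<eta> opt lim]
  have eq: "wbar = what" using penalty(1) by blast
  have "snd what \<in> nonneg_orthant"
    using closed_sequentially[OF closed_nonneg_orthant _ tendsto_snd[OF lim(2)]] orthant by blast
  then have wbar: "wbar \<in> UNIV \<times> nonneg_orthant" using eq by (cases wbar) auto
  \<comment> \<open>Both points lie in the orthant, where the indicator inside \<open>?g\<close> is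
    0.\<close>
  have "?f wbar + R wbar \<le> ?f u + R u" if "u \<in> UNIV \<times> nonneg_orthant" for u
    using penalty(2)[of u] that wbar by (auto simp: ind_def)
  then have "?f wbar + R wbar = (INF u \<in> UNIV \<times> nonneg_orthant. ?f u + R u)"
    using wbar by (intro antisym INF_greatest INF_lower) auto
  then show ?thesis
    using eq wbar by (simp add: optimal_on_def case_prod_beta)
qed

end
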